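(* Let $\sigma$ be an irreducible incommensurable normalized multiscale substitution scheme in $\mathbb{R}^d$ with prototiles $T_1,\dots,T_n$. Let $\mathcal{S}\in\mathbb{X}_\sigma^F$ and $s>0$ satisfy $F_s(\mathcal{S})=\mathcal{S}$, and let $\varepsilon>0$. Then there exists $K\in\mathbb{N}$ such that for every integer $k\ge K$, every tile $T$ in $\mathcal{S}$ and every $j\in\{1,\dots,n\}$, the set $$\mathrm{Scales}(e^{ks}T,j):=\{\alpha:\ \text{the patch supported on } e^{ks}T \text{ in } F_{ks}(\mathcal{S})=\mathcal{S}\text{ contains a translated copy of }\alpha T_j\}$$ is $\varepsilon$-dense in $(\beta_j^{\min},1]$. In particular, the set of scales in which tiles of each type $j$ appear in a stationary tiling is dense in the interval of legal scales $(\beta_j^{\min},1]$.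
   Context: Schemes. A tile in $\mathbb{R}^d$ is a bounded Lebesgue measurable set $T$ of positive measure $\mathrm{vol}\,T$ whose boundary has measure zero. A tessellation of $U\subset\mathbb{R}^d$ is a collection of tiles with pairwise disjoint interiors and union $U$; it is called a patch if $U$ is bounded ($U$ is then the support of the patch) and a tiling if $U=\mathbb{R}^d$. A multiscale substitution scheme $\sigma=(\tau_\sigma,\varrho_\sigma)$ consists of a finite list of prototiles $\tau_\sigma=(T_1,\dots,T_n)$ and, for each $i$, a tessellation $\varrho_\sigma(T_i)$ of $T_i$ all of whose tiles are translates of rescaled prototiles; the list of these rescaled prototiles is $\omega_\sigma(T_i)=(\alpha_{ij}^{(k)}T_j:\ j=1,\dots,n,\ k=1,\dots,k_{ij})$. Here $0<\alpha_{ij}^{(k)}<1$. A translate of $\alpha T_j$, $\alpha>0$, is a tile of type $j$ and scale $\alpha$. Standing assumptions: $\sigma$ is normalized, i.e. $\mathrm{vol}\,T_i=1$ for all $i$; distinct prototiles are geometrically different ($T_i$ is not a rescaled copy of $T_j$ for $i\ne j$), so the type of a tile is determined by the tile. For each $j$, $\beta_j^{\min}:=\min\{\alpha:\ \exists i,\ \varrho_\sigma(T_i)\text{ contains a copy of }\alpha T_j\}$; $(\beta_j^{\min},1]$ is the interval of legal scales of tiles of type $j$. Substitution semi-flow. For $t\ge 0$, $F_t(T_i)$ is the patch supported on $e^tT_i$ obtained by starting with $e^tT_i$ and repeatedly substituting (according to the rescaled rule $\varrho_\sigma$) every tile of volume $>1$, until all tiles have volume $\le 1$. In the same way $F_t$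 is defined on every tile $T$ that is a translate of $\alpha T_i$ with $0<\alpha\le 1$ ($F_t(T)$ is supported on $e^tT$), on patches of such tiles, and on tilings by such tiles (tile by tile). $\sigma$ is irreducible if for all $i,j$ there is $t>0$ such that $F_t(T_i)$ contains a tile of type $j$. $\sigma$ is incommensurable if there are $i,j$ and $t_1,t_2>0$ with $t_1\notin\mathbb{Q}t_2$ such that $F_{t_1}(T_i)$ contains a tile of type $i$ and unit volume and $F_{t_2}(T_j)$ contains a tile of type $j$ and unit volume. Let $\mathscr{S}_{i\to i}$ be the set of $t$ such that $F_t(T_i)$ contains a tile of type $i$ and unit volume. Tiling space. Position each $T_i$ so that the origin is an interior point. Let $\mathscr{P}_\sigma=\{F_t(T_i): t\ge0,\ i=1,\dots,n\}$. Identify a patch or tiling with the closed set which is the union of the boundaries of its tiles. On closed subsets of $\mathbb{R}^d$ use the metric $D(A_1,A_2)=\inf(\{r>0: A_1\cap B(0,1/r)\subset A_2^{+r},\ A_2\cap B(0,1/r)\subset A_1^{+r}\}\cup\{1\})$, where $A^{+r}$ is the $r$-neighborhood of $A$ and $B(x,R)$ is the open Euclidean ball. $\mathbb{X}^F_\sigma$ is the set of all tilings $\mathcal{T}$ of $\mathbb{R}^d$ such that every sub-patch of $\mathcal{T}$ is a limit, with respect to $D$, of translated sub-patches of elements of $\mathscr{P}_\sigma$. Every tile of every $\mathcal{T}\in\mathbb{X}^F_\sigma$ is a rescaled copy (of scale at most $1$) of a prototile, and $F_t$ maps $\mathbb{X}_\sigma^F$ to itself. A stationary tiling is a tiling $\mathcal{S}\in\mathbb{X}_\sigma^F$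 of the form $\mathcal{S}=\bigcup_{k\ge0}F_{a+ks}(T_i)$ with $0<s\in\mathscr{S}_{i\to i}$, $a\ge0$, where $T_i$ is positioned so that the origin is an interior point and the patches $F_{a+ks}(T_i)$, $k\ge 0$, are nested (each a sub-patch of the next); it satisfies $F_s(\mathcal{S})=\mathcal{S}$. *)

theory Defs
  imports "HOL-Analysis.Analysis"
begin

definition tile :: "'a::euclidean_space set \<Rightarrow> bool" where
  "tile T \<longleftrightarrow> bounded T \<and> T \<in> sets lebesgue \<and> measure lebesgue T > 0 \<and> negligible (frontier T)"

definition tessellation :: "'a::euclidean_space set set \<Rightarrow> 'a set \<Rightarrow> bool" where
  "tessellation P U \<longleftrightarrow>
     (\<forall>T\<in>P. tile T) \<and> pairwise (\<lambda>A B. interior A \<inter> interior B = {}) P \<and> \<Union>P = U"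

definition patch :: "'a::euclidean_space set set \<Rightarrow> bool" where
  "patch P \<longleftrightarrow> (\<exists>U. bounded U \<and> tessellation P U)"

definition tiling :: "'a::euclidean_space set set \<Rightarrow> bool" where
  "tiling P \<longleftrightarrow> tessellation P UNIV"

definition subpatch :: "'a::euclidean_space set set \<Rightarrow> 'a set set \<Rightarrow> bool" where
  "subpatch Q P \<longleftrightarrow> Q \<subseteq> P \<and> patch Q"

text \<open>The set \<open>x + \<alpha> A\<close>.\<close>

definition copy :: "'a::real_vector \<Rightarrow> real \<Rightarrow> 'a set \<Rightarrow> 'a set" where
  "copy x \<alpha> A = (\<lambda>y. x + \<alpha> *\<^sub>R y) ` A"

text \<open>A scheme is a pair of a list of prototiles and a rule, which is only relevant on the
  prototiles. Types are the indices of that list, hence start at 0. The prototiles are not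
  required to contain the origin: all notions below are invariant under translating the
  prototiles (and their rules).\<close>

record 'a scheme =
  prototiles :: "'a set list"
  rule :: "'a set \<Rightarrow> 'a set set"

definition num_types :: "'a scheme \<Rightarrow> nat" where
  "num_types \<sigma> = length (prototiles \<sigma>)"

definition proto :: "'a scheme \<Rightarrow> nat \<Rightarrow> 'a set" where
  "proto \<sigma> i = prototiles \<sigma> ! i"

definition tile_of :: "'a::euclidean_space scheme \<Rightarrow> nat \<Rightarrow> real \<Rightarrow> 'a set \<Rightarrow> bool" where
  "tile_of \<sigma> j \<alpha> T \<longleftrightarrow> j < num_types \<sigma> \<and> \<alpha> > 0 \<and> (\<exists>x. T = copy x \<alpha> (proto \<sigma> j))"

definition substitution_scheme :: "'a::euclidean_space scheme \<Rightarrow> bool" where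
  "substitution_scheme \<sigma> \<longleftrightarrow>
     (\<forall>i < num_types \<sigma>.
        tile (proto \<sigma> i) \<and>
        finite (rule \<sigma> (proto \<sigma> i)) \<and>
        tessellation (rule \<sigma> (proto \<sigma> i)) (proto \<sigma> i) \<and>
        (\<forall>T \<in> rule \<sigma> (proto \<sigma> i). \<exists>j \<alpha>. \<alpha> < 1 \<and> tile_of \<sigma> j \<alpha> T))"

definition normalized :: "'a::euclidean_space scheme \<Rightarrow> bool" where
  "normalized \<sigma> \<longleftrightarrow> (\<forall>i < num_types \<sigma>. measure lebesgue (proto \<sigma> i) = 1)"

definition geometrically_different :: "'a::euclidean_space scheme \<Rightarrow> bool" where
  "geometrically_different \<sigma> \<longleftrightarrow>
     (\<forall>i < num_types \<sigma>. \<forall>j < num_types \<sigma>. i \<noteq> j \<longrightarrow> \<not> (\<exists>\<alpha>. tile_of \<sigma> j \<alpha> (proto \<sigma> i)))"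

definition beta_min :: "'a::euclidean_space scheme \<Rightarrow> nat \<Rightarrow> real" where
  "beta_min \<sigma> j = Min {\<alpha>. \<exists>i < num_types \<sigma>. \<exists>T \<in> rule \<sigma> (proto \<sigma> i). tile_of \<sigma> j \<alpha> T}"

text \<open>The rescaled rule. Type, scale and position of a tile are determined by the tile if the
  scheme is normalized with geometrically different prototiles, so there is only one choice of
  \<open>i\<close>, \<open>\<alpha>\<close>, \<open>x\<close>.\<close>

definition subst_tile :: "'a::euclidean_space scheme \<Rightarrow> 'a set \<Rightarrow> 'a set set" where
  "subst_tile \<sigma> T =
     {copy x \<alpha> S | x \<alpha> i S.
        i < num_types \<sigma> \<and> \<alpha> > 0 \<and> T = copy x \<alpha> (proto \<sigma> i) \<and> S \<in> rule \<sigma> (proto \<sigma> i)}"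

text \<open>All tiles that occur at some stage when one starts with \<open>T\<^sub>0\<close> and repeatedly substitutes the
  tiles of volume greater than 1. Those of volume at most 1 form the final patch.\<close>

inductive_set generated :: "'a::euclidean_space scheme \<Rightarrow> 'a set \<Rightarrow> 'a set set"
  for \<sigma> :: "'a scheme" and T\<^sub>0 :: "'a set" where
  start: "T\<^sub>0 \<in> generated \<sigma> T\<^sub>0"
| step: "\<lbrakk>T \<in> generated \<sigma> T\<^sub>0; measure lebesgue T > 1; S \<in> subst_tile \<sigma> T\<rbrakk>
    \<Longrightarrow> S \<in> generated \<sigma> T\<^sub>0"

text \<open>\<open>F\<^sub>t(T)\<close> for a single tile is \<open>flow \<sigma> t {T}\<close>. Meaningful for \<open>t \<ge> 0\<close> and tiles of scale at
  most 1.\<close>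

definition flow :: "'a::euclidean_space scheme \<Rightarrow> real \<Rightarrow> 'a set set \<Rightarrow> 'a set set" where
  "flow \<sigma> t P = (\<Union>T\<in>P. {S \<in> generated \<sigma> (copy 0 (exp t) T). measure lebesgue S \<le> 1})"

definition irreducible_scheme :: "'a::euclidean_space scheme \<Rightarrow> bool" where
  "irreducible_scheme \<sigma> \<longleftrightarrow>
     (\<forall>i < num_types \<sigma>. \<forall>j < num_types \<sigma>.
        \<exists>t > 0. \<exists>T \<in> flow \<sigma> t {proto \<sigma> i}. \<exists>\<alpha>. tile_of \<sigma> j \<alpha> T)"

definition return_times :: "'a::euclidean_space scheme \<Rightarrow> nat \<Rightarrow> real set" where
  "return_times \<sigma> i =
     {t. t \<ge> 0 \<and> (\<exists>T \<in> flow \<sigma> t {proto \<sigma> i}. (\<exists>\<alpha>. tile_of \<sigma> i \<alpha> T) \<and> measure lebesgue T = 1)}"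

definition incommensurable :: "'a::euclidean_space scheme \<Rightarrow> bool" where
  "incommensurable \<sigma> \<longleftrightarrow>
     (\<exists>i < num_types \<sigma>. \<exists>j < num_types \<sigma>. \<exists>t\<^sub>1 \<in> return_times \<sigma> i. \<exists>t\<^sub>2 \<in> return_times \<sigma> j.
        t\<^sub>1 > 0 \<and> t\<^sub>2 > 0 \<and> t\<^sub>1 \<notin> {q * t\<^sub>2 | q. q \<in> \<rat>})"

definition skeleton :: "'a::euclidean_space set set \<Rightarrow> 'a set" where
  "skeleton P = (\<Union>T\<in>P. frontier T)"

definition nbhd :: "'a::euclidean_space set \<Rightarrow> real \<Rightarrow> 'a set" where
  "nbhd A r = (\<Union>a\<in>A. ball a r)"

definition set_dist :: "'a::euclidean_space set \<Rightarrow> 'a set \<Rightarrow> real" where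
  "set_dist A\<^sub>1 A\<^sub>2 =
     Inf ({r. r > 0 \<and> A\<^sub>1 \<inter> ball 0 (1 / r) \<subseteq> nbhd A\<^sub>2 r \<and> A\<^sub>2 \<inter> ball 0 (1 / r) \<subseteq> nbhd A\<^sub>1 r} \<union> {1})"

definition generating_patches :: "'a::euclidean_space scheme \<Rightarrow> 'a set set set" where
  "generating_patches \<sigma> = {flow \<sigma> t {proto \<sigma> i} | t i. t \<ge> 0 \<and> i < num_types \<sigma>}"

text \<open>The requirement on the tiles is explicit because skeletons only see boundaries: if two
  squares meet in a corner, a tile that is their union has the same skeleton as the two
  squares, so the condition on sub-patches alone does not exclude it.\<close>

definition tiling_space :: "'a::euclidean_space scheme \<Rightarrow> 'a set set set" where
  "tiling_space \<sigma> =
     {P. tiling P \<and>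
         (\<forall>T\<in>P. \<exists>j \<alpha>. \<alpha> \<le> 1 \<and> tile_of \<sigma> j \<alpha> T) \<and>
         (\<forall>Q. subpatch Q P \<longrightarrow>
            (\<exists>R :: nat \<Rightarrow> 'a set set.
               (\<forall>m. \<exists>G \<in> generating_patches \<sigma>. \<exists>Q' x. subpatch Q' G \<and> R m = copy x 1 ` Q') \<and>
               (\<lambda>m. set_dist (skeleton (R m)) (skeleton Q)) \<longlonglongrightarrow> 0))}"

text \<open>The translate \<open>copy x 1 (proto \<sigma> i)\<close> is the positioning of the prototile.\<close>

definition stationary_tiling :: "'a::euclidean_space scheme \<Rightarrow> 'a set set \<Rightarrow> bool" where
  "stationary_tiling \<sigma> P \<longleftrightarrow> P \<in> tiling_space \<sigma> \<and>
     (\<exists>i < num_types \<sigma>. \<exists>s \<in> return_times \<sigma> i. \<exists>a \<ge> 0. \<exists>x.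
        let T = copy x 1 (proto \<sigma> i); F = (\<lambda>k::nat. flow \<sigma> (a + real k * s) {T})
        in s > 0 \<and> 0 \<in> interior T \<and> (\<forall>k. subpatch (F k) (F (Suc k))) \<and> P = (\<Union>k. F k))"

definition scales :: "'a::euclidean_space scheme \<Rightarrow> 'a set set \<Rightarrow> nat \<Rightarrow> real set" where
  "scales \<sigma> P j = {\<alpha>. \<exists>T\<in>P. tile_of \<sigma> j \<alpha> T}"

definition patch_on :: "'a::euclidean_space set set \<Rightarrow> 'a set \<Rightarrow> 'a set set" where
  "patch_on P U = {T \<in> P. T \<subseteq> U}"

definition eps_dense_in :: "real \<Rightarrow> real set \<Rightarrow> real set \<Rightarrow> bool" where
  "eps_dense_in \<epsilon> A I \<longleftrightarrow> (\<forall>x\<in>I. \<exists>a \<in> A \<inter> I. dist x a < \<epsilon>)"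

definition dense_in :: "real set \<Rightarrow> real set \<Rightarrow> bool" where
  "dense_in A I \<longleftrightarrow> I \<subseteq> closure (A \<inter> I)"

end

theory Submission
  imports Defs
begin

text \<open>
  A scheme defines a finite directed graph on the types: an edge from \<open>i\<close> to \<open>j\<close> for each tile of
  type \<open>j\<close> in the substitution of \<open>T\<^sub>i\<close>, of length \<open>- ln \<beta>\<close> if the tile has scale \<open>\<beta>\<close>. A walk of length
  \<open>l\<close> from \<open>i\<close> to \<open>j\<close> leads from a tile of type \<open>i\<close> and scale \<open>e\<^sup>t\<close> to a descendant of type \<open>j\<close> and scale
  \<open>e\<^bsup>t-l\<^esup>\<close> (\<open>generated_imp_walk\<close>, \<open>walk_imp_generated\<close>), so questions about scales become questions
  about lengths of walks.

  Incommensurability and irreducibility give two closed walks at a common type whose lengths \<open>a\<close>, \<open>b\<close>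
  have irrational ratio (\<open>incommensurable_closed_walks\<close>). By Dirichlet's theorem the numbers
  \<open>M a + N b\<close>, with \<open>M\<close> and \<open>N\<close> natural, leave gaps that tend to 0 far out on the line
  (\<open>eventually_dense_irrational_ratio\<close>), and by irreducibility the same is true of the lengths of
  walks between any two types. To reach a scale near \<open>\<alpha>\<close> in \<open>(\<beta>\<^sub>j, 1]\<close>, let the last edge be one that
  shrinks to type \<open>j\<close> by the minimal factor \<open>\<beta>\<^sub>j\<close>: its parent, of scale about \<open>\<alpha> / \<beta>\<^sub>j\<close>, is larger than 1
  and is therefore substituted, whereas the child is final. So the scales of type \<open>j\<close> in the patch of
  a tile of scale \<open>e\<^sup>t\<close> are \<open>\<epsilon>\<close>-dense as soon as \<open>t\<close> is large, uniformly in the tile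
  (\<open>generated_scales_eps_dense\<close>).

  If \<open>F\<^sub>s(S) = S\<close>, the semi-flow property (\<open>flow_add\<close>) gives \<open>F\<^bsub>ks\<^esub>(S) = S\<close>, so \<open>S\<close> contains the patch
  generated by \<open>e\<^bsup>ks\<^esup> T\<close> for each of its tiles \<open>T\<close>. For one \<open>K\<close> to serve all tiles, their scales must be
  bounded away from 0. This holds in the whole tiling space: a patch \<open>F\<^sub>t(T\<^sub>i)\<close> has no tiles of scale
  less than the smallest scale in the rules, and a limit of skeletons of such patches cannot contain
  the frontier of a much smaller tile in isolation (\<open>tiling_space_scales_lower_bound\<close>).
\<close>


section \<open>Sums of multiples of two numbers with irrational ratio\<close>

text \<open>With a fixed total number \<open>K\<close> of steps \<open>p\<close> or \<open>q\<close>, trading steps \<open>q\<close> for steps \<open>p\<close> one by one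
  moves the sum from \<open>K q\<close> upwards in increments \<open>\<delta> = p - q < \<epsilon>\<close>. Once \<open>K \<delta> > q\<close>, these sums reach
  beyond \<open>(K + 1) q\<close>, where the sums of \<open>K + 1\<close> steps take over.\<close>

lemma eventually_dense_two_close_steps:
  fixes p q \<epsilon> :: real
  assumes "0 < q" "q < p" "p < q + \<epsilon>"
  shows "\<forall>\<^sub>F x in at_top. \<exists>(M::nat) (N::nat). x < M * p + N * q \<and> M * p + N * q < x + \<epsilon>"
proof -
  define \<delta> where "\<delta> = p - q"
  have \<delta>: "0 < \<delta>" "\<delta> < \<epsilon>" using assms by (auto simp: \<delta>_def)
  obtain N\<^sub>0 :: nat where N\<^sub>0: "q < N\<^sub>0 * \<delta>"
    using reals_Archimedean3[OF \<delta>(1)] by blast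
  have "\<exists>(M::nat) (N::nat). x < M * p + N * q \<and> M * p + N * q < x + \<epsilon>" if x: "x \<ge> N\<^sub>0 * q" for x
  proof -
    have x0: "x \<ge> 0" using x assms(1) by (smt (verit) mult_nonneg_nonneg of_nat_0_le_iff)
    define K where "K = nat \<lfloor>x / q\<rfloor>"
    have K1: "real K * q \<le> x" and K2: "x < (real K + 1) * q"
    proof -
      have "0 \<le> x / q" using x0 assms(1) by simp
      hence *: "real K = of_int \<lfloor>x / q\<rfloor>" unfolding K_def by simp
      have "real K \<le> x / q" "x / q < real K + 1" unfolding * by linarith+
      thus "real K * q \<le> x" "x < (real K + 1) * q" using assms(1) by (simp_all add: field_simps)
    qed
    have KN: "N\<^sub>0 \<le> K"
    proof -
      have "real N\<^sub>0 * q < (real K + 1) * q" using x K2 by linarith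
      hence "real N\<^sub>0 < real K + 1" using assms(1) by simp
      thus ?thesis by linarith
    qed
    define y where "y = (x - real K * q) / \<delta>"
    have y0: "0 \<le> y" using K1 \<delta> by (simp add: y_def)
    have yq: "y < N\<^sub>0"
    proof -
      have "x - real K * q < q" using K2 by (simp add: algebra_simps)
      hence "x - real K * q < N\<^sub>0 * \<delta>" using N\<^sub>0 by linarith
      thus ?thesis using \<delta> by (simp add: y_def field_simps)
    qed
    define r where "r = Suc (nat \<lfloor>y\<rfloor>)"
    have r: "y < real r" "real r \<le> y + 1" using y0 unfolding r_def by linarith+
    have "r \<le> N\<^sub>0" using yq y0 unfolding r_def by linarith
    hence rK: "r \<le> K" using KN by simp
    have val: "real r * p + real (K - r) * q = real K * q + real r * \<delta>"
      using rK by (simp add: \<delta>_def of_nat_diff algebra_simps)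
    have "y * \<delta> = x - real K * q" using \<delta> by (simp add: y_def)
    moreover have "y * \<delta> < real r * \<delta>" "real r * \<delta> \<le> y * \<delta> + \<delta>"
      using mult_strict_right_mono[OF r(1) \<delta>(1)] mult_right_mono[OF r(2), of \<delta>] \<delta>(1)
      by (simp_all add: distrib_right)
    ultimately have "x < real K * q + real r * \<delta>" "real K * q + real r * \<delta> < x + \<epsilon>"
      using \<delta> by linarith+
    thus ?thesis using val by metis
  qed
  thus ?thesis unfolding eventually_at_top_linorder by blast
qed

text \<open>By Dirichlet's approximation theorem some multiples \<open>m a\<close> and \<open>n b\<close> differ by less than \<open>\<epsilon>\<close>, and
  they are distinct because the ratio is irrational. They serve as the two close steps.\<close>

lemma eventually_dense_irrational_ratio:
  fixes a b \<epsilon> :: real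
  assumes "0 < a" "0 < b" "a / b \<notin> \<rat>" "0 < \<epsilon>"
  shows "\<forall>\<^sub>F x in at_top. \<exists>(M::nat) (N::nat). x < M * a + N * b \<and> M * a + N * b < x + \<epsilon>"
proof -
  \<comment> \<open>Closeness below \<open>a\<close> as well forces \<open>h b > 0\<close>, so that \<open>h\<close> is a natural number.\<close>
  define e where "e = min \<epsilon> a"
  have e: "0 < e" "e \<le> \<epsilon>" "e \<le> a" using assms by (auto simp: e_def)
  obtain N :: nat where N: "b / e < N" using reals_Archimedean2 by blast
  have "0 < b / e" using assms e by simp
  hence N0: "N > 0" using N by (metis of_nat_0_less_iff order_less_trans)
  obtain h k :: int where hk: "0 < k" "\<bar>of_int k * (a / b) - of_int h\<bar> < 1 / real N"
    using Dirichlet_approx[OF N0] by metis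
  have "\<bar>of_int k * a - of_int h * b\<bar> = \<bar>of_int k * (a / b) - of_int h\<bar> * b"
    using assms(2) by (simp add: abs_mult_pos' field_simps flip: abs_mult_pos)
  also have "\<dots> < 1 / real N * b"
    using hk assms(2) by (intro mult_strict_right_mono) auto
  also have "\<dots> < e" using N N0 e(1) by (simp add: field_simps)
  finally have close: "\<bar>of_int k * a - of_int h * b\<bar> < e" .
  have "a \<le> of_int k * a" using hk(1) assms(1) by simp
  hence "0 < of_int h * b" using close e by linarith
  hence h: "0 < h" using assms(2) by (simp add: zero_less_mult_iff)
  have ne: "of_int k * a \<noteq> of_int h * b"
  proof
    assume "of_int k * a = of_int h * b"
    hence "a / b = of_int h / of_int k" using assms(2) hk(1) by (simp add: field_simps)
    thus False using assms(3) by simp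
  qed
  define m n where "m = nat k" and "n = nat h"
  have mn: "of_int k = real m" "of_int h = real n" "0 < m" "0 < n"
    using hk(1) h by (auto simp: m_def n_def)
  have regroup: "\<exists>(M::nat) (N::nat). x < M * a + N * b \<and> M * a + N * b < x + \<epsilon>"
    if "x < real M * (m * a) + real N * (n * b)" "real M * (m * a) + real N * (n * b) < x + \<epsilon>"
    for x and M N :: nat
    using that by (intro exI[of _ "M * m"] exI[of _ "N * n"]) (simp add: mult.assoc)
  show ?thesis
  proof (cases "n * b < m * a")
    case True
    have "\<forall>\<^sub>F x in at_top. \<exists>(M::nat) (N::nat). x < M * (m * a) + N * (n * b)
            \<and> M * (m * a) + N * (n * b) < x + \<epsilon>"
      by (rule eventually_dense_two_close_steps) (use True close e assms mn in auto)
    thus ?thesis by (rule eventually_mono) (use regroup in blast)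
  next
    case False
    have "\<forall>\<^sub>F x in at_top. \<exists>(M::nat) (N::nat). x < M * (n * b) + N * (m * a)
            \<and> M * (n * b) + N * (m * a) < x + \<epsilon>"
      by (rule eventually_dense_two_close_steps) (use False close e assms mn ne in auto)
    thus ?thesis by (rule eventually_mono) (use regroup in \<open>metis add.commute\<close>)
  qed
qed


section \<open>Rescaled copies, frontiers and the distance of skeletons\<close>

lemma copy_copy: "copy x a (copy y b A) = copy (x + a *\<^sub>R y) (a * b) A"
  by (auto simp: copy_def image_image algebra_simps)

lemma copy_0_1 [simp]: "copy 0 1 A = A"
  by (simp add: copy_def)

lemma copy_copy_inverse:
  assumes "a \<noteq> 0"
  shows "copy (- (1 / a) *\<^sub>R x) (1 / a) (copy x a A) = A"
  using assms by (simp add: copy_copy)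

lemma copy_mono: "A \<subseteq> B \<Longrightarrow> copy x a A \<subseteq> copy x a B"
  by (auto simp: copy_def)

lemma measure_copy:
  fixes A :: "'a::euclidean_space set"
  shows "measure lebesgue (copy x a A) = \<bar>a\<bar> ^ DIM('a) * measure lebesgue A"
  using measure_lebesgue_affine[of a x A] by (simp add: copy_def add.commute)

lemma frontier_copy:
  fixes A :: "'a::euclidean_space set"
  assumes "a \<noteq> 0"
  shows "frontier (copy x a A) = copy x a (frontier A)"
proof -
  have lin: "linear ((*\<^sub>R) a :: 'a \<Rightarrow> 'a)" by (simp add: linear_iff algebra_simps)
  have inj: "inj ((*\<^sub>R) a :: 'a \<Rightarrow> 'a)" using assms by (simp add: inj_def)
  have scale: "frontier ((*\<^sub>R) a ` A) = (*\<^sub>R) a ` frontier A"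
    unfolding frontier_def
    by (simp add: interior_injective_linear_image[OF lin inj]
        closure_injective_linear_image[OF lin inj, symmetric] image_set_diff[OF inj])
  have "copy x a B = (+) x ` ((*\<^sub>R) a ` B)" for B :: "'a set"
    by (simp add: copy_def image_image)
  thus ?thesis by (simp add: frontier_translation scale)
qed

lemma dist_copy: "dist (x + a *\<^sub>R p) (x + a *\<^sub>R q) = \<bar>a\<bar> * dist p q"
  for x p q :: "'a::real_normed_vector"
  by (simp add: dist_norm flip: scaleR_diff_right)

text \<open>The interior is nonempty because the tile has positive measure and a null frontier. From an
  interior point, two opposite rays leave the bounded set through different frontier points.\<close>

lemma frontier_two_points:
  fixes T :: "'a::euclidean_space set"
  assumes "tile T"
  obtains p q where "p \<in> frontier T" "q \<in> frontier T" "p \<noteq> q"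
proof -
  have T: "bounded T" "measure lebesgue T > 0" "negligible (frontier T)"
    using assms by (auto simp: tile_def)
  have "interior T \<noteq> {}"
  proof
    assume "interior T = {}"
    hence "T \<subseteq> frontier T" using closure_subset by (auto simp: frontier_def)
    hence "negligible T" using T(3) negligible_subset by blast
    thus False using T(2) by (simp add: negligible_imp_measure0)
  qed
  then obtain a where a: "a \<in> interior T" by blast
  obtain b :: 'a where b: "b \<in> Basis" using nonempty_Basis by blast
  hence b0: "b \<noteq> 0" by auto
  obtain d where d: "0 < d" "a + d *\<^sub>R b \<in> frontier T"
    using ray_to_frontier[OF T(1) a b0] by metis
  obtain d' where d': "0 < d'" "a + d' *\<^sub>R (- b) \<in> frontier T"
    using ray_to_frontier[OF T(1) a] b0 by (metis neg_equal_0_iff_equal)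
  have "a + d *\<^sub>R b \<noteq> a + d' *\<^sub>R (- b)"
  proof
    assume "a + d *\<^sub>R b = a + d' *\<^sub>R (- b)"
    hence "(d + d') *\<^sub>R b = 0" by (simp add: algebra_simps)
    thus False using d d' b0 by simp
  qed
  thus ?thesis using that d d' by blast
qed

lemma set_dist_less:
  assumes "set_dist A B < r" "r \<le> 1"
  obtains r' where "0 < r'" "r' < r" "A \<inter> ball 0 (1 / r') \<subseteq> nbhd B r'" "B \<inter> ball 0 (1 / r') \<subseteq> nbhd A r'"
proof -
  let ?S = "{r. r > 0 \<and> A \<inter> ball 0 (1 / r) \<subseteq> nbhd B r \<and> B \<inter> ball 0 (1 / r) \<subseteq> nbhd A r} \<union> {1}"
  obtain r' where "r' \<in> ?S" "r' < r" using assms(1) cInf_lessD[of ?S r] unfolding set_dist_def by blast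
  thus ?thesis using that assms(2) by auto
qed


section \<open>The semi-flow property\<close>

lemma measure_expand_gt_1:
  fixes T :: "'a::euclidean_space set"
  assumes "1 \<le> a" "measure lebesgue T > 1"
  shows "measure lebesgue (copy x a T) > 1"
proof -
  have "1 \<le> a ^ DIM('a)" using assms(1) by simp
  hence "1 * measure lebesgue T \<le> a ^ DIM('a) * measure lebesgue T"
    using assms(2) by (intro mult_right_mono) auto
  also have "a ^ DIM('a) * measure lebesgue T = measure lebesgue (copy x a T)"
    using assms(1) by (simp add: measure_copy)
  finally show ?thesis using assms(2) by simp
qed

lemma subst_tile_copy:
  assumes "c > 0" "S \<in> subst_tile \<sigma> T"
  shows "copy y c S \<in> subst_tile \<sigma> (copy y c T)"
proof -
  obtain x \<alpha> i R where *: "S = copy x \<alpha> R" "i < num_types \<sigma>" "\<alpha> > 0"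
    "T = copy x \<alpha> (proto \<sigma> i)" "R \<in> rule \<sigma> (proto \<sigma> i)"
    using assms(2) by (auto simp: subst_tile_def)
  have "c * \<alpha> > 0" using * assms by simp
  moreover have "copy y c S = copy (y + c *\<^sub>R x) (c * \<alpha>) R"
    "copy y c T = copy (y + c *\<^sub>R x) (c * \<alpha>) (proto \<sigma> i)"
    using * by (simp_all add: copy_copy)
  ultimately show ?thesis using *(2,5) unfolding subst_tile_def by blast
qed

lemma subst_tile_copyE:
  assumes "c > 0" "S \<in> subst_tile \<sigma> (copy y c T)"
  obtains R where "R \<in> subst_tile \<sigma> T" "S = copy y c R"
proof
  let ?z = "- (1 / c) *\<^sub>R y"
  show "copy ?z (1 / c) S \<in> subst_tile \<sigma> T"
    using subst_tile_copy[of "1 / c" S \<sigma> "copy y c T" ?z] assms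
    by (simp only: copy_copy_inverse[OF less_imp_neq[OF assms(1), symmetric]] zero_less_divide_1_iff)
  show "S = copy y c (copy ?z (1 / c) S)" using assms(1) by (simp add: copy_copy)
qed

lemma generated_trans:
  assumes "S \<in> generated \<sigma> T" "U \<in> generated \<sigma> S"
  shows "U \<in> generated \<sigma> T"
  using assms(2,1) by (induction rule: generated.induct) (auto intro: generated.step)

lemma generated_expand:
  assumes "S \<in> generated \<sigma> T" "1 \<le> c"
  shows "copy y c S \<in> generated \<sigma> (copy y c T)"
  using assms
proof (induction rule: generated.induct)
  case (step T S)
  have "copy y c S \<in> subst_tile \<sigma> (copy y c T)" using step by (intro subst_tile_copy) auto
  thus ?case using step by (meson generated.step measure_expand_gt_1)
qed (rule generated.start)

lemma generated_volume_le_1: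
  assumes "U \<in> generated \<sigma> T" "measure lebesgue T \<le> 1"
  shows "U = T"
  using assms by induction auto

text \<open>Substituting \<open>c T\<close> until all volumes are at most 1 can be done in two stages: as long as the tile
  without the factor \<open>c\<close> is still large, the process runs parallel to that on \<open>T\<close>; as soon as this
  tile has volume at most 1, it belongs to the final patch of \<open>T\<close> and the process goes on inside its
  expanded copy. This is the nontrivial half of the semi-flow property.\<close>

lemma generated_expand_cases:
  assumes "U \<in> generated \<sigma> (copy y c T)" "1 \<le> c"
  shows "(\<exists>V \<in> generated \<sigma> T. measure lebesgue V > 1 \<and> U = copy y c V) \<or>
         (\<exists>V \<in> generated \<sigma> T. measure lebesgue V \<le> 1 \<and> U \<in> generated \<sigma> (copy y c V))"
  using assms(1)
proof (induction rule: generated.induct)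
  case start
  show ?case using generated.start linorder_not_less by blast
next
  case (step U S)
  from step.IH show ?case
  proof (elim disjE bexE conjE)
    fix V assume V: "V \<in> generated \<sigma> T" "measure lebesgue V > 1" "U = copy y c V"
    obtain R where R: "R \<in> subst_tile \<sigma> V" "S = copy y c R"
      using subst_tile_copyE step.hyps(3) V(3) assms(2) by (metis less_le_trans zero_less_one)
    have "R \<in> generated \<sigma> T" using V R by (blast intro: generated.step)
    thus ?thesis using R generated.start by (metis linorder_not_less)
  next
    fix V assume "V \<in> generated \<sigma> T" "measure lebesgue V \<le> 1" "U \<in> generated \<sigma> (copy y c V)"
    thus ?thesis using step.hyps by (blast intro: generated.step)
  qed
qed

lemma flow_add:
  assumes "0 \<le> s" "0 \<le> t"
  shows "flow \<sigma> t (flow \<sigma> s P) = flow \<sigma> (s + t) P"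
proof -
  have split: "copy 0 (exp (s + t)) T = copy 0 (exp t) (copy 0 (exp s) T)" for T :: "'a set"
    by (simp add: copy_copy exp_add mult.commute)
  have expand: "1 \<le> exp t" using assms by simp
  have "U \<in> flow \<sigma> t (flow \<sigma> s P) \<longleftrightarrow> U \<in> flow \<sigma> (s + t) P" for U
  proof
    assume "U \<in> flow \<sigma> t (flow \<sigma> s P)"
    then obtain T V where TV: "T \<in> P" "V \<in> generated \<sigma> (copy 0 (exp s) T)"
      "U \<in> generated \<sigma> (copy 0 (exp t) V)" "measure lebesgue U \<le> 1"
      by (auto simp: flow_def)
    have "U \<in> generated \<sigma> (copy 0 (exp (s + t)) T)"
      unfolding split by (rule generated_trans[OF generated_expand[OF TV(2) expand] TV(3)])
    thus "U \<in> flow \<sigma> (s + t) P" using TV by (auto simp: flow_def)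
  next
    assume "U \<in> flow \<sigma> (s + t) P"
    then obtain T where T: "T \<in> P" "U \<in> generated \<sigma> (copy 0 (exp t) (copy 0 (exp s) T))"
      "measure lebesgue U \<le> 1"
      by (auto simp: flow_def split)
    have "\<not> (\<exists>V \<in> generated \<sigma> (copy 0 (exp s) T). measure lebesgue V > 1 \<and> U = copy 0 (exp t) V)"
      using measure_expand_gt_1[OF expand] T(3) by (metis linorder_not_less)
    then obtain V where "V \<in> generated \<sigma> (copy 0 (exp s) T)" "measure lebesgue V \<le> 1"
      "U \<in> generated \<sigma> (copy 0 (exp t) V)"
      using generated_expand_cases[OF T(2) expand] by blast
    thus "U \<in> flow \<sigma> t (flow \<sigma> s P)" using T(1,3) by (auto simp: flow_def)
  qed
  thus ?thesis by blast
qed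

lemma flow_0:
  assumes "\<And>T. T \<in> P \<Longrightarrow> measure lebesgue T \<le> 1"
  shows "flow \<sigma> 0 P = P"
proof -
  have "{S \<in> generated \<sigma> T. measure lebesgue S \<le> 1} = {T}" if "T \<in> P" for T
    using assms[OF that] generated_volume_le_1 generated.start by blast
  thus ?thesis by (simp add: flow_def)
qed

text \<open>The semi-flow property gives the step from \<open>k\<close> to \<open>k + 1\<close>; the bound on the volumes gives the case
  \<open>k = 0\<close>, since \<open>F\<^sub>0\<close> substitutes larger tiles.\<close>

lemma flow_fixed_multiples:
  assumes "\<And>T. T \<in> P \<Longrightarrow> measure lebesgue T \<le> 1" "0 \<le> s" "flow \<sigma> s P = P"
  shows "flow \<sigma> (real k * s) P = P"
proof (induction k)
  case 0
  show ?case using flow_0[OF assms(1)] by simp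
next
  case (Suc k)
  have "flow \<sigma> (real (Suc k) * s) P = flow \<sigma> s (flow \<sigma> (real k * s) P)"
    using assms(2) by (subst flow_add) (auto simp: algebra_simps)
  thus ?case using Suc assms(3) by simp
qed


section \<open>Types and scales of generated tiles\<close>

locale normalized_scheme =
  fixes \<sigma> :: "'a::euclidean_space scheme"
  assumes scheme: "substitution_scheme \<sigma>"
    and normalized: "normalized \<sigma>"
    and different: "geometrically_different \<sigma>"
begin

lemma measure_tile_of:
  assumes "tile_of \<sigma> j \<alpha> T"
  shows "measure lebesgue T = \<alpha> ^ DIM('a)"
proof -
  obtain x where x: "j < num_types \<sigma>" "\<alpha> > 0" "T = copy x \<alpha> (proto \<sigma> j)"
    using assms unfolding tile_of_def by blast
  have "measure lebesgue (proto \<sigma> j) = 1" using normalized x(1) unfolding normalized_def by blast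
  thus ?thesis using x(2,3) by (simp add: measure_copy)
qed

text \<open>The volume determines the scale by normalization. Undoing the scale exhibits one prototile
  as a rescaled copy of the other, so the types agree by geometric difference.\<close>

lemma tile_of_unique:
  assumes "tile_of \<sigma> i \<alpha> T" "tile_of \<sigma> j \<beta> T"
  shows "i = j" "\<alpha> = \<beta>"
proof -
  have pos: "\<alpha> > 0" "\<beta> > 0" using assms by (auto simp: tile_of_def)
  have "\<alpha> ^ DIM('a) = \<beta> ^ DIM('a)" using assms measure_tile_of by metis
  thus "\<alpha> = \<beta>" using pos by (metis DIM_positive less_imp_le power_eq_imp_eq_base)
  obtain x y where xy: "i < num_types \<sigma>" "j < num_types \<sigma>"
    "T = copy x \<alpha> (proto \<sigma> i)" "T = copy y \<beta> (proto \<sigma> j)"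
    using assms unfolding tile_of_def by blast
  have "proto \<sigma> i = copy (- (1 / \<alpha>) *\<^sub>R x) (1 / \<alpha>) T"
    using copy_copy_inverse[of \<alpha> x "proto \<sigma> i"] pos xy(3) by simp
  also have "\<dots> = copy (- (1 / \<alpha>) *\<^sub>R x + (1 / \<alpha>) *\<^sub>R y) (1 / \<alpha> * \<beta>) (proto \<sigma> j)"
    unfolding xy(4) copy_copy ..
  finally have "tile_of \<sigma> j (1 / \<alpha> * \<beta>) (proto \<sigma> i)"
    using xy(2) pos unfolding tile_of_def by (meson divide_pos_pos mult_pos_pos zero_less_one)
  thus "i = j" using different xy(1,2) unfolding geometrically_different_def by blast
qed

lemma measure_tile_of_gt_1:
  assumes "tile_of \<sigma> j \<alpha> T"
  shows "measure lebesgue T > 1 \<longleftrightarrow> \<alpha> > 1"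
proof -
  have "\<alpha> > 0" using assms by (auto simp: tile_of_def)
  thus ?thesis using measure_tile_of[OF assms] DIM_positive[where 'a='a]
    by (metis less_imp_le one_less_power linorder_not_less power_le_one)
qed

lemma tile_of_copy:
  assumes "tile_of \<sigma> j \<alpha> T" "c > 0"
  shows "tile_of \<sigma> j (c * \<alpha>) (copy y c T)"
  using assms unfolding tile_of_def by (metis copy_copy mult_pos_pos)

lemma rule_scale_less_1:
  assumes "k < num_types \<sigma>" "R \<in> rule \<sigma> (proto \<sigma> k)" "tile_of \<sigma> j \<beta> R"
  shows "\<beta> < 1"
  using assms scheme tile_of_unique unfolding substitution_scheme_def by metis

lemma subst_tileE:
  assumes "S \<in> subst_tile \<sigma> T" "tile_of \<sigma> k \<alpha> T"
  obtains R j \<beta> where "R \<in> rule \<sigma> (proto \<sigma> k)" "tile_of \<sigma> j \<beta> R" "tile_of \<sigma> j (\<alpha> * \<beta>) S"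
proof -
  obtain x \<gamma> i R where *: "S = copy x \<gamma> R" "i < num_types \<sigma>" "\<gamma> > 0"
    "T = copy x \<gamma> (proto \<sigma> i)" "R \<in> rule \<sigma> (proto \<sigma> i)"
    using assms(1) unfolding subst_tile_def by blast
  have "tile_of \<sigma> i \<gamma> T" using * unfolding tile_of_def by blast
  hence eq: "i = k" "\<gamma> = \<alpha>" using assms(2) tile_of_unique by blast+
  obtain j \<beta> where R: "tile_of \<sigma> j \<beta> R"
    using scheme *(2,5) unfolding substitution_scheme_def by blast
  have "tile_of \<sigma> j (\<alpha> * \<beta>) S" using tile_of_copy[OF R *(3)] eq *(1) by simp
  thus ?thesis using that R *(5) eq by blast
qed

lemma subst_tileI:
  assumes "tile_of \<sigma> k \<alpha> T" "R \<in> rule \<sigma> (proto \<sigma> k)" "tile_of \<sigma> j \<beta> R"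
  obtains S where "S \<in> subst_tile \<sigma> T" "tile_of \<sigma> j (\<alpha> * \<beta>) S"
proof -
  obtain x where x: "k < num_types \<sigma>" "\<alpha> > 0" "T = copy x \<alpha> (proto \<sigma> k)"
    using assms(1) unfolding tile_of_def by blast
  hence "copy x \<alpha> R \<in> subst_tile \<sigma> T" using assms(2) unfolding subst_tile_def by blast
  thus ?thesis using that tile_of_copy[OF assms(3) x(2)] by blast
qed

lemma subst_tile_subset:
  assumes "S \<in> subst_tile \<sigma> T"
  shows "S \<subseteq> T"
proof -
  obtain x \<gamma> i R where *: "S = copy x \<gamma> R" "i < num_types \<sigma>"
    "T = copy x \<gamma> (proto \<sigma> i)" "R \<in> rule \<sigma> (proto \<sigma> i)"
    using assms unfolding subst_tile_def by blast
  have "R \<subseteq> proto \<sigma> i"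
    using scheme *(2,4) unfolding substitution_scheme_def tessellation_def by blast
  thus ?thesis using * copy_mono by blast
qed

lemma generated_subset: "S \<in> generated \<sigma> T \<Longrightarrow> S \<subseteq> T"
  by (induction rule: generated.induct) (use subst_tile_subset in blast)+

end


section \<open>Walks in the substitution graph\<close>

text \<open>Walks in the weighted graph of the scheme: one edge from \<open>k\<close> to \<open>j\<close> for each tile of type \<open>j\<close>
  in the substitution of \<open>T\<^sub>k\<close>. The length \<open>- ln \<beta>\<close> of an edge is the time that the flow needs to
  inflate a tile of scale \<open>\<beta>\<close> to unit volume.\<close>

inductive walk :: "'a::euclidean_space scheme \<Rightarrow> nat \<Rightarrow> nat \<Rightarrow> real \<Rightarrow> bool" for \<sigma> i where
  refl: "i < num_types \<sigma> \<Longrightarrow> walk \<sigma> i i 0"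
| snoc: "\<lbrakk>walk \<sigma> i k l; R \<in> rule \<sigma> (proto \<sigma> k); tile_of \<sigma> j \<beta> R\<rbrakk> \<Longrightarrow> walk \<sigma> i j (l - ln \<beta>)"

lemma walk_type: "walk \<sigma> i j l \<Longrightarrow> j < num_types \<sigma>"
  by (induction rule: walk.induct) (auto simp: tile_of_def)

lemma walk_trans:
  assumes "walk \<sigma> j k m" "walk \<sigma> i j l"
  shows "walk \<sigma> i k (l + m)"
  using assms
proof (induction rule: walk.induct)
  case (snoc k m R j' \<beta>)
  thus ?case using walk.snoc[of \<sigma> i k "l + m" R j' \<beta>] by (simp add: add_diff_eq)
qed simp

lemma walk_multiple:
  assumes "walk \<sigma> i i a"
  shows "walk \<sigma> i i (real m * a)"
proof (induction m)
  case 0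
  show ?case using walk.refl walk_type[OF assms] by simp
next
  case (Suc m)
  thus ?case using walk_trans[OF assms Suc] by (simp add: algebra_simps)
qed

context normalized_scheme
begin

text \<open>Following the ancestors of a generated tile gives a walk; its length is the total loss in
  logarithmic scale.\<close>

lemma generated_imp_walk:
  assumes "S \<in> generated \<sigma> T" "tile_of \<sigma> i \<alpha> T"
  shows "\<exists>j \<gamma>. tile_of \<sigma> j \<gamma> S \<and> walk \<sigma> i j (ln \<alpha> - ln \<gamma>)"
  using assms
proof (induction rule: generated.induct)
  case start
  have "i < num_types \<sigma>" using start by (simp add: tile_of_def)
  thus ?case using start walk.refl by (metis diff_self)
next
  case (step U S)
  then obtain k \<gamma> where k: "tile_of \<sigma> k \<gamma> U" "walk \<sigma> i k (ln \<alpha> - ln \<gamma>)" by blast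
  obtain R j \<beta> where R: "R \<in> rule \<sigma> (proto \<sigma> k)" "tile_of \<sigma> j \<beta> R" "tile_of \<sigma> j (\<gamma> * \<beta>) S"
    using subst_tileE[OF step.hyps(3) k(1)] by blast
  have "\<gamma> > 0" "\<beta> > 0" using k R by (auto simp: tile_of_def)
  hence "ln \<alpha> - ln (\<gamma> * \<beta>) = (ln \<alpha> - ln \<gamma>) - ln \<beta>" by (simp add: ln_mult)
  thus ?case using R(3) walk.snoc[OF k(2) R(1,2)] by metis
qed

text \<open>Conversely, a walk can be followed as long as the tiles stay larger than 1. Since scales shrink
  along every edge, it suffices that the tile at the end of the walk is larger than 1.\<close>

lemma walk_imp_generated:
  assumes "walk \<sigma> i j l" "tile_of \<sigma> i \<alpha> T" "\<alpha> * exp (- l) > 1"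
  shows "\<exists>S \<in> generated \<sigma> T. tile_of \<sigma> j (\<alpha> * exp (- l)) S"
  using assms
proof (induction rule: walk.induct)
  case refl
  thus ?case using generated.start by force
next
  case (snoc k l R j \<beta>)
  have k: "k < num_types \<sigma>" using snoc.hyps(1) by (rule walk_type)
  have \<beta>: "0 < \<beta>" "\<beta> < 1"
    using snoc.hyps rule_scale_less_1[OF k] by (auto simp: tile_of_def)
  have "exp (- (l - ln \<beta>)) = exp (- l) * exp (ln \<beta>)" by (simp flip: exp_add)
  hence eq: "\<alpha> * exp (- (l - ln \<beta>)) = \<alpha> * exp (- l) * \<beta>" using \<beta>(1) by simp
  have \<alpha>: "\<alpha> > 0" using snoc.prems by (simp add: tile_of_def)
  have "\<alpha> * exp (- l) * \<beta> \<le> \<alpha> * exp (- l) * 1" using \<alpha> \<beta> by (intro mult_left_mono) auto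
  hence large: "\<alpha> * exp (- l) > 1" using snoc.prems(2) unfolding eq by linarith
  then obtain U where U: "U \<in> generated \<sigma> T" "tile_of \<sigma> k (\<alpha> * exp (- l)) U"
    using snoc by blast
  obtain S where S: "S \<in> subst_tile \<sigma> U" "tile_of \<sigma> j (\<alpha> * exp (- l) * \<beta>) S"
    using subst_tileI[OF U(2) snoc.hyps(2,3)] by blast
  have "S \<in> generated \<sigma> T"
    using U S large measure_tile_of_gt_1 by (blast intro: generated.step)
  thus ?case using S(2) unfolding eq by blast
qed

end


section \<open>Lower bound for scales in the tiling space\<close>

context normalized_scheme
begin

definition rule_scales :: "real set" where
  "rule_scales = {\<beta>. \<exists>k < num_types \<sigma>. \<exists>R \<in> rule \<sigma> (proto \<sigma> k). \<exists>j. tile_of \<sigma> j \<beta> R}"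

lemma finite_rule_scales: "finite rule_scales"
proof (rule finite_subset)
  show "rule_scales \<subseteq>
    (\<lambda>R. root DIM('a) (measure lebesgue R)) ` (\<Union>k<num_types \<sigma>. rule \<sigma> (proto \<sigma> k))"
  proof
    fix \<beta> assume "\<beta> \<in> rule_scales"
    then obtain k R j where *: "k < num_types \<sigma>" "R \<in> rule \<sigma> (proto \<sigma> k)" "tile_of \<sigma> j \<beta> R"
      unfolding rule_scales_def by blast
    have "\<beta> > 0" using *(3) by (simp add: tile_of_def)
    hence "\<beta> = root DIM('a) (measure lebesgue R)"
      using measure_tile_of[OF *(3)] by (simp add: real_root_power_cancel)
    thus "\<beta> \<in> (\<lambda>R. root DIM('a) (measure lebesgue R)) ` (\<Union>k<num_types \<sigma>. rule \<sigma> (proto \<sigma> k))"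
      using * by blast
  qed
  show "finite ((\<lambda>R. root DIM('a) (measure lebesgue R)) ` (\<Union>k<num_types \<sigma>. rule \<sigma> (proto \<sigma> k)))"
    using scheme unfolding substitution_scheme_def by blast
qed

lemma rule_scales_lower_bound:
  obtains b where "0 < b" "b \<le> 1" "\<And>\<beta>. \<beta> \<in> rule_scales \<Longrightarrow> b \<le> \<beta>"
proof
  let ?b = "Min (insert 1 rule_scales)"
  have "\<beta> > 0" if "\<beta> \<in> insert 1 rule_scales" for \<beta>
    using that by (auto simp: rule_scales_def tile_of_def)
  thus "0 < ?b" using finite_rule_scales by (subst Min_gr_iff) auto
  show "?b \<le> 1" "\<And>\<beta>. \<beta> \<in> rule_scales \<Longrightarrow> ?b \<le> \<beta>" using finite_rule_scales by auto
qed

text \<open>Only tiles larger than 1 are substituted, so every tile that arises has at least the scale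
  prescribed by the rule.\<close>

lemma generated_scale_lower_bound:
  assumes b: "b \<le> 1" "\<And>\<beta>. \<beta> \<in> rule_scales \<Longrightarrow> b \<le> \<beta>"
    and S: "S \<in> generated \<sigma> T" and T: "tile_of \<sigma> i \<alpha> T" "1 \<le> \<alpha>"
  shows "\<exists>j \<gamma>. tile_of \<sigma> j \<gamma> S \<and> b \<le> \<gamma>"
  using S
proof (cases rule: generated.cases)
  case start
  thus ?thesis using T b(1) by force
next
  case (step U)
  obtain k \<gamma> where U: "tile_of \<sigma> k \<gamma> U" using generated_imp_walk[OF step(1) T(1)] by blast
  hence k: "k < num_types \<sigma>" by (simp add: tile_of_def)
  obtain R j \<beta> where R: "R \<in> rule \<sigma> (proto \<sigma> k)" "tile_of \<sigma> j \<beta> R" "tile_of \<sigma> j (\<gamma> * \<beta>) S"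
    using subst_tileE[OF step(3) U] by blast
  have "\<beta> \<in> rule_scales" using k R unfolding rule_scales_def by blast
  hence "b \<le> \<beta>" by (rule b)
  moreover have "\<gamma> > 1" using step(2) measure_tile_of_gt_1[OF U] by simp
  moreover have "\<beta> > 0" using R(2) by (simp add: tile_of_def)
  ultimately have "b \<le> \<gamma> * \<beta>" by (smt (verit) mult_le_cancel_right1)
  thus ?thesis using R(3) by blast
qed

text \<open>The diameter of the frontier of a tile measures its scale, up to constants common to all types.
  Skeletons are unions of frontiers, so this is how the metric on skeletons sees scales.\<close>

lemma frontier_diameter_bounds:
  obtains w D where "0 < w" "0 < D"
    "\<And>j \<gamma> X p q. \<lbrakk>tile_of \<sigma> j \<gamma> X; p \<in> frontier X; q \<in> frontier X\<rbrakk> \<Longrightarrow> dist p q \<le> \<gamma> * D"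
    "\<And>j \<gamma> X. tile_of \<sigma> j \<gamma> X \<Longrightarrow> \<exists>p \<in> frontier X. \<exists>q \<in> frontier X. \<gamma> * w \<le> dist p q"
proof -
  have proto: "tile (proto \<sigma> j)" if "j < num_types \<sigma>" for j
    using scheme that unfolding substitution_scheme_def by blast
  have "bounded (frontier (proto \<sigma> j))" if "j < num_types \<sigma>" for j
    using proto[OF that] bounded_closure unfolding tile_def frontier_def
    by (meson Diff_subset bounded_subset)
  hence "bounded (\<Union>j<num_types \<sigma>. frontier (proto \<sigma> j))" by (intro bounded_UN) auto
  then obtain D\<^sub>0 where D\<^sub>0: "\<And>j p q. \<lbrakk>j < num_types \<sigma>; p \<in> frontier (proto \<sigma> j);
      q \<in> frontier (proto \<sigma> j)\<rbrakk> \<Longrightarrow> dist p q \<le> D\<^sub>0"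
    unfolding bounded_two_points by blast
  define D where "D = max 1 D\<^sub>0"
  have "\<forall>j. \<exists>pq. j < num_types \<sigma> \<longrightarrow> fst pq \<in> frontier (proto \<sigma> j) \<and>
      snd pq \<in> frontier (proto \<sigma> j) \<and> fst pq \<noteq> snd pq"
    using frontier_two_points[OF proto] by (metis fst_conv snd_conv)
  then obtain f where f: "\<And>j. j < num_types \<sigma> \<Longrightarrow> fst (f j) \<in> frontier (proto \<sigma> j) \<and>
      snd (f j) \<in> frontier (proto \<sigma> j) \<and> fst (f j) \<noteq> snd (f j)"
    by metis
  define w where "w = Min (insert 1 ((\<lambda>j. dist (fst (f j)) (snd (f j))) ` {..<num_types \<sigma>}))"
  have w0: "0 < w" unfolding w_def by (subst Min_gr_iff) (use f in auto)
  have w: "w \<le> dist (fst (f j)) (snd (f j))" if "j < num_types \<sigma>" for j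
    unfolding w_def using that by (intro Min_le) auto
  show ?thesis
  proof
    show "0 < w" "0 < D" using w0 by (auto simp: D_def)
  next
    fix j \<gamma> X p q assume X: "tile_of \<sigma> j \<gamma> X" "p \<in> frontier X" "q \<in> frontier X"
    then obtain x where x: "j < num_types \<sigma>" "\<gamma> > 0" "X = copy x \<gamma> (proto \<sigma> j)"
      unfolding tile_of_def by blast
    have "frontier X = copy x \<gamma> (frontier (proto \<sigma> j))" using x by (simp add: frontier_copy)
    then obtain p' q' where pq: "p' \<in> frontier (proto \<sigma> j)" "q' \<in> frontier (proto \<sigma> j)"
      "p = x + \<gamma> *\<^sub>R p'" "q = x + \<gamma> *\<^sub>R q'"
      using X by (auto simp: copy_def)
    have "dist p' q' \<le> D" using D\<^sub>0[OF x(1) pq(1,2)] by (simp add: D_def)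
    thus "dist p q \<le> \<gamma> * D" using x(2) unfolding pq(3,4) dist_copy by simp
  next
    fix j \<gamma> X assume "tile_of \<sigma> j \<gamma> X"
    then obtain x where x: "j < num_types \<sigma>" "\<gamma> > 0" "X = copy x \<gamma> (proto \<sigma> j)"
      unfolding tile_of_def by blast
    have X: "frontier X = copy x \<gamma> (frontier (proto \<sigma> j))" using x by (simp add: frontier_copy)
    have "\<gamma> * w \<le> dist (x + \<gamma> *\<^sub>R fst (f j)) (x + \<gamma> *\<^sub>R snd (f j))"
      using w[OF x(1)] x(2) unfolding dist_copy by simp
    moreover have "x + \<gamma> *\<^sub>R fst (f j) \<in> frontier X" "x + \<gamma> *\<^sub>R snd (f j) \<in> frontier X"
      using f[OF x(1)] unfolding X copy_def by blast+
    ultimately show "\<exists>p \<in> frontier X. \<exists>q \<in> frontier X. \<gamma> * w \<le> dist p q" by blast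
  qed
qed

lemma generating_patch_scales:
  assumes b: "b \<le> 1" "\<And>\<beta>. \<beta> \<in> rule_scales \<Longrightarrow> b \<le> \<beta>"
    and G: "G \<in> generating_patches \<sigma>" "X \<in> G"
  shows "\<exists>j \<gamma>. tile_of \<sigma> j \<gamma> X \<and> b \<le> \<gamma> \<and> \<gamma> \<le> 1"
proof -
  obtain t i where ti: "t \<ge> 0" "i < num_types \<sigma>"
    "X \<in> generated \<sigma> (copy 0 (exp t) (proto \<sigma> i))" "measure lebesgue X \<le> 1"
    using G unfolding generating_patches_def flow_def by blast
  have "tile_of \<sigma> i (exp t) (copy 0 (exp t) (proto \<sigma> i))"
    using ti(2) unfolding tile_of_def by auto
  then obtain j \<gamma> where "tile_of \<sigma> j \<gamma> X" "b \<le> \<gamma>"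
    using generated_scale_lower_bound[OF b ti(3)] ti(1) one_le_exp_iff by blast
  thus ?thesis using ti(4) measure_tile_of_gt_1 by (metis linorder_not_less)
qed

text \<open>A single tile \<open>T\<close> of a tiling is a sub-patch, so its frontier is a limit of skeletons of patches
  whose tiles have scale at least \<open>b\<close>. Some such tile \<open>X\<close> has a frontier point near the frontier of
  \<open>T\<close>, and then the whole frontier of \<open>X\<close>, whose diameter is bounded, lies in the ball where the two
  skeletons are close. Hence the frontier of \<open>T\<close> is, up to an arbitrarily small error, at least as
  large as that of \<open>X\<close>, which bounds the scale of \<open>T\<close> from below.\<close>

lemma tiling_space_scales_lower_bound:
  obtains c where "0 < c"
    "\<And>P T j \<alpha>. \<lbrakk>P \<in> tiling_space \<sigma>; T \<in> P; tile_of \<sigma> j \<alpha> T\<rbrakk> \<Longrightarrow> c \<le> \<alpha>"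
proof -
  obtain b where b: "0 < b" "b \<le> 1" "\<And>\<beta>. \<beta> \<in> rule_scales \<Longrightarrow> b \<le> \<beta>"
    by (rule rule_scales_lower_bound) blast
  obtain w D where w: "0 < w" and D: "0 < D"
    and upper: "\<And>j \<gamma> X p q. \<lbrakk>tile_of \<sigma> j \<gamma> X; p \<in> frontier X; q \<in> frontier X\<rbrakk>
      \<Longrightarrow> dist p q \<le> \<gamma> * D"
    and lower: "\<And>j \<gamma> X. tile_of \<sigma> j \<gamma> X
      \<Longrightarrow> \<exists>p \<in> frontier X. \<exists>q \<in> frontier X. \<gamma> * w \<le> dist p q"
    using frontier_diameter_bounds by metis
  have "b * w / D \<le> \<alpha>" if P: "P \<in> tiling_space \<sigma>" and T: "T \<in> P" "tile_of \<sigma> j \<alpha> T" for P T j \<alpha>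
  proof -
    have "tile T" using P T(1) unfolding tiling_space_def tiling_def tessellation_def by blast
    hence bT: "bounded T" and sub: "subpatch {T} P"
      using T(1) by (auto simp: tile_def subpatch_def patch_def tessellation_def)
    then obtain R where R: "\<And>m. \<exists>G \<in> generating_patches \<sigma>. \<exists>Q x. subpatch Q G \<and> R m = copy x 1 ` Q"
      and lim: "(\<lambda>m. set_dist (skeleton (R m)) (skeleton {T})) \<longlonglongrightarrow> 0"
      using P unfolding tiling_space_def by blast
    have skel: "skeleton {T} = frontier T" by (simp add: skeleton_def)
    obtain z where z: "z \<in> frontier T" using lower[OF T(2)] by blast
    have "b * w \<le> \<alpha> * D + e" if e: "e > 0" for e
    proof -
      \<comment> \<open>The ball of radius \<open>1 / r\<close> contains the frontier of every tile of scale at most 1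
      that has a frontier point at distance less than 1 from \<open>z\<close>.\<close>
      define r where "r = min (e / 2) (min 1 (1 / (norm z + 1 + D)))"
      have pos: "0 < norm z + 1 + D" using D norm_ge_zero[of z] by linarith
      hence r: "0 < r" using e by (simp add: r_def)
      have r_le: "r \<le> 1" "2 * r \<le> e" "r \<le> 1 / (norm z + 1 + D)"
        unfolding r_def by linarith+
      obtain m where "set_dist (skeleton (R m)) (frontier T) < r"
        using order_tendstoD(2)[OF lim r] skel by (auto simp: eventually_sequentially)
      then obtain r' where r': "0 < r'" "r' < r"
        "skeleton (R m) \<inter> ball 0 (1 / r') \<subseteq> nbhd (frontier T) r'"
        "frontier T \<inter> ball 0 (1 / r') \<subseteq> nbhd (skeleton (R m)) r'"
        using set_dist_less r_le(1) by metis
      have "r' < 1 / (norm z + 1 + D)" using r_le(3) r'(2) by linarith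
      hence big: "norm z + 1 + D < 1 / r'" using r'(1) pos by (simp add: field_simps)
      have "z \<in> frontier T \<inter> ball 0 (1 / r')" using z big D by simp
      then obtain x where x: "x \<in> skeleton (R m)" "dist x z < r'"
        using r'(4) by (auto simp: nbhd_def)
      then obtain X where X: "X \<in> R m" "x \<in> frontier X" by (auto simp: skeleton_def)
      obtain G Q y where G: "G \<in> generating_patches \<sigma>" "subpatch Q G" "R m = copy y 1 ` Q"
        using R by blast
      then obtain X' where X': "X' \<in> G" "X = copy y 1 X'"
        using X(1) by (auto simp: subpatch_def)
      obtain i \<gamma> where i: "tile_of \<sigma> i \<gamma> X'" "b \<le> \<gamma>" "\<gamma> \<le> 1"
        using generating_patch_scales[OF b(2,3) G(1) X'(1)] by blast
      have Xi: "tile_of \<sigma> i \<gamma> X" using tile_of_copy[OF i(1), of 1 y] X'(2) by simp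
      \<comment> \<open>The whole frontier of \<open>X\<close> stays in the ball, so it is close to the frontier of \<open>T\<close>.\<close>
      have near: "\<exists>p' \<in> frontier T. dist p' p < r'" if p: "p \<in> frontier X" for p
      proof -
        have "dist p x \<le> \<gamma> * D" using upper[OF Xi p X(2)] .
        also have "\<dots> \<le> 1 * D" using i(3) D by (intro mult_right_mono) auto
        finally have "dist p z < D + 1" using x(2) r_le(1) r'(2) dist_triangle[of p z x] by linarith
        hence "norm p < norm z + 1 + D"
          using norm_triangle_ineq2[of p z] by (simp add: dist_norm)
        hence "p \<in> ball 0 (1 / r')" using big by simp
        moreover have "p \<in> skeleton (R m)" using p X(1) by (auto simp: skeleton_def)
        ultimately have "p \<in> nbhd (frontier T) r'" using r'(3) by blast
        thus ?thesis by (auto simp: nbhd_def)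
      qed
      obtain p q where pq: "p \<in> frontier X" "q \<in> frontier X" "\<gamma> * w \<le> dist p q"
        using lower[OF Xi] by blast
      obtain p' q' where pq': "p' \<in> frontier T" "q' \<in> frontier T" "dist p' p < r'" "dist q' q < r'"
        using near pq by meson
      have "b * w \<le> \<gamma> * w" using i(2) w by simp
      also have "\<dots> \<le> dist p q" by (rule pq)
      also have "\<dots> \<le> dist p p' + dist p' q' + dist q' q"
        using dist_triangle[of p q p'] dist_triangle[of p' q q'] by linarith
      also have "\<dots> \<le> \<alpha> * D + e"
        using upper[OF T(2) pq'(1,2)] pq'(3,4) r_le(2) r'(2) by (simp add: dist_commute)
      finally show ?thesis .
    qed
    hence "b * w \<le> \<alpha> * D" by (rule field_le_epsilon)
    thus ?thesis using D by (simp add: field_simps)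
  qed
  thus ?thesis using that[of "b * w / D"] b(1) w D by simp
qed

end


section \<open>Lengths of walks are eventually dense\<close>

locale irreducible_substitution = normalized_scheme +
  assumes irreducible: "irreducible_scheme \<sigma>"
begin

lemma walk_exists:
  assumes "i < num_types \<sigma>" "j < num_types \<sigma>"
  obtains l where "l > 0" "walk \<sigma> i j l"
proof -
  obtain t T \<alpha> where t: "t > 0" "T \<in> flow \<sigma> t {proto \<sigma> i}" "tile_of \<sigma> j \<alpha> T"
    using irreducible assms unfolding irreducible_scheme_def by blast
  hence T: "T \<in> generated \<sigma> (copy 0 (exp t) (proto \<sigma> i))" "measure lebesgue T \<le> 1"
    by (auto simp: flow_def)
  have "tile_of \<sigma> i (exp t) (copy 0 (exp t) (proto \<sigma> i))"
    using assms(1) unfolding tile_of_def by auto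
  then obtain j' \<gamma> where "tile_of \<sigma> j' \<gamma> T" "walk \<sigma> i j' (t - ln \<gamma>)"
    using generated_imp_walk[OF T(1)] by force
  hence walk: "walk \<sigma> i j (t - ln \<alpha>)" using tile_of_unique[OF _ t(3)] by blast
  have "\<alpha> > 0" "\<alpha> \<le> 1"
    using t(3) T(2) measure_tile_of_gt_1[OF t(3)] by (auto simp: tile_of_def)
  hence "ln \<alpha> \<le> 0" by simp
  hence "t - ln \<alpha> > 0" using t(1) by linarith
  thus ?thesis using that walk by blast
qed

lemma beta_min_attained:
  assumes "j < num_types \<sigma>"
  obtains k R where "k < num_types \<sigma>" "R \<in> rule \<sigma> (proto \<sigma> k)" "tile_of \<sigma> j (beta_min \<sigma> j) R"
proof -
  let ?A = "{\<alpha>. \<exists>i < num_types \<sigma>. \<exists>T \<in> rule \<sigma> (proto \<sigma> i). tile_of \<sigma> j \<alpha> T}"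
  obtain l where l: "l > 0" "walk \<sigma> j j l" using walk_exists[OF assms assms] .
  \<comment> \<open>The last edge of a closed walk of positive length ends at type \<open>j\<close>.\<close>
  have "?A \<noteq> {}"
    using l(2)
  proof (cases rule: walk.cases)
    case refl
    thus ?thesis using l(1) by simp
  next
    case (snoc k l' R \<beta>)
    thus ?thesis using walk_type by blast
  qed
  moreover have "finite ?A"
    by (rule finite_subset[OF _ finite_rule_scales]) (auto simp: rule_scales_def)
  ultimately have "beta_min \<sigma> j \<in> ?A" unfolding beta_min_def by (rule Min_in[rotated])
  thus ?thesis using that by blast
qed

end

locale incommensurable_substitution = irreducible_substitution +
  assumes incommensurable: "incommensurable \<sigma>"
begin

lemma return_time_walk:
  assumes "i < num_types \<sigma>" "t \<in> return_times \<sigma> i"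
  shows "walk \<sigma> i i t"
proof -
  obtain T \<alpha> where T: "T \<in> generated \<sigma> (copy 0 (exp t) (proto \<sigma> i))" "tile_of \<sigma> i \<alpha> T"
    "measure lebesgue T = 1"
    using assms(2) unfolding return_times_def flow_def by blast
  have "tile_of \<sigma> i (exp t) (copy 0 (exp t) (proto \<sigma> i))"
    using assms(1) unfolding tile_of_def by auto
  then obtain j \<gamma> where "tile_of \<sigma> j \<gamma> T" "walk \<sigma> i j (t - ln \<gamma>)"
    using generated_imp_walk[OF T(1)] by force
  hence walk: "walk \<sigma> i i (t - ln \<alpha>)" using tile_of_unique[OF _ T(2)] by blast
  have "\<alpha> > 0" "\<alpha> ^ DIM('a) = 1"
    using T measure_tile_of[OF T(2)] by (auto simp: tile_of_def)
  hence "\<alpha> = 1" by (metis DIM_positive less_imp_le power_eq_1_iff power_one power_eq_imp_eq_base zero_le_one)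
  thus ?thesis using walk by simp
qed

text \<open>Incommensurability concerns closed walks of lengths \<open>t\<^sub>1\<close> and \<open>t\<^sub>2\<close> at two possibly different types.
  Irreducibility supplies a closed walk from \<open>i\<close> through \<open>j\<close>, of length \<open>u + v\<close>, on which the detour \<open>t\<^sub>2\<close>
  can be inserted. The lengths \<open>u + v\<close> and \<open>u + t\<^sub>2 + v\<close> cannot both be rational multiples of \<open>t\<^sub>1\<close>, as
  their difference is \<open>t\<^sub>2\<close>.\<close>

lemma incommensurable_closed_walks:
  obtains i a b where "walk \<sigma> i i a" "walk \<sigma> i i b" "0 < a" "0 < b" "a / b \<notin> \<rat>"
proof -
  obtain i j t\<^sub>1 t\<^sub>2 where ij: "i < num_types \<sigma>" "j < num_types \<sigma>"
    and t: "t\<^sub>1 \<in> return_times \<sigma> i" "t\<^sub>2 \<in> return_times \<sigma> j" "t\<^sub>1 > 0" "t\<^sub>2 > 0"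
      "t\<^sub>1 \<notin> {q * t\<^sub>2 | q. q \<in> \<rat>}"
    using incommensurable unfolding incommensurable_def by blast
  have w: "walk \<sigma> i i t\<^sub>1" "walk \<sigma> j j t\<^sub>2" using return_time_walk ij t by auto
  obtain u where u: "u > 0" "walk \<sigma> i j u" using walk_exists[OF ij] .
  obtain v where v: "v > 0" "walk \<sigma> j i v" using walk_exists[OF ij(2,1)] .
  have uv: "walk \<sigma> i i (u + v)" using walk_trans[OF v(2) u(2)] .
  have utv: "walk \<sigma> i i (u + t\<^sub>2 + v)" using walk_trans[OF v(2) walk_trans[OF w(2) u(2)]] .
  show ?thesis
  proof (cases "(u + v) / t\<^sub>1 \<in> \<rat>")
    case False
    thus ?thesis using that[OF uv w(1)] u v t by simp
  next
    case True
    have "(u + t\<^sub>2 + v) / t\<^sub>1 \<notin> \<rat>"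
    proof
      assume "(u + t\<^sub>2 + v) / t\<^sub>1 \<in> \<rat>"
      hence "(u + t\<^sub>2 + v) / t\<^sub>1 - (u + v) / t\<^sub>1 \<in> \<rat>" using True by (rule Rats_diff)
      hence "t\<^sub>2 / t\<^sub>1 \<in> \<rat>" by (simp add: add_divide_distrib)
      hence "inverse (t\<^sub>2 / t\<^sub>1) \<in> \<rat>" by (rule Rats_inverse)
      moreover have "t\<^sub>1 = inverse (t\<^sub>2 / t\<^sub>1) * t\<^sub>2" using t by simp
      ultimately show False using t(5) by blast
    qed
    thus ?thesis using that[OF utv w(1)] u v t by simp
  qed
qed

text \<open>A walk from \<open>i\<close> to the type \<open>c\<close> that carries the two closed walks, then closed walks at \<open>c\<close>, then a
  walk to \<open>j\<close>: the lengths in the middle are eventually dense, and the ends shift them by a constant.\<close>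

lemma walk_lengths_eventually_dense:
  assumes "\<epsilon> > 0"
  shows "\<forall>\<^sub>F x in at_top. \<forall>i<num_types \<sigma>. \<forall>j<num_types \<sigma>. \<exists>l. walk \<sigma> i j l \<and> x < l \<and> l < x + \<epsilon>"
proof -
  obtain c a b where c: "walk \<sigma> c c a" "walk \<sigma> c c b" "0 < a" "0 < b" "a / b \<notin> \<rat>"
    by (rule incommensurable_closed_walks)
  have closed: "walk \<sigma> c c (real M * a + real N * b)" for M N
    using walk_trans[OF walk_multiple[OF c(2)] walk_multiple[OF c(1)]] .
  obtain X where X: "\<And>x. x \<ge> X \<Longrightarrow> \<exists>(M::nat) (N::nat). x < M * a + N * b \<and> M * a + N * b < x + \<epsilon>"
    using eventually_dense_irrational_ratio[OF c(3,4,5) assms]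
    unfolding eventually_at_top_linorder by blast
  have "\<forall>\<^sub>F x in at_top. \<exists>l. walk \<sigma> i j l \<and> x < l \<and> l < x + \<epsilon>"
    if ij: "i < num_types \<sigma>" "j < num_types \<sigma>" for i j
  proof -
    have c_type: "c < num_types \<sigma>" using walk_type[OF c(1)] .
    obtain u where u: "walk \<sigma> i c u" using walk_exists[OF ij(1) c_type] by blast
    obtain v where v: "walk \<sigma> c j v" using walk_exists[OF c_type ij(2)] by blast
    have "\<exists>l. walk \<sigma> i j l \<and> x < l \<and> l < x + \<epsilon>" if x: "x \<ge> X + u + v" for x
    proof -
      obtain M N :: nat where MN: "x - u - v < M * a + N * b" "M * a + N * b < x - u - v + \<epsilon>"
        using X[of "x - u - v"] x by auto
      have "walk \<sigma> i j (u + (M * a + N * b) + v)"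
        using walk_trans[OF v walk_trans[OF closed u]] .
      thus ?thesis using MN by (intro exI[of _ "u + (M * a + N * b) + v"]) auto
    qed
    thus ?thesis unfolding eventually_at_top_linorder by blast
  qed
  hence "\<forall>\<^sub>F x in at_top. \<forall>i\<in>{..<num_types \<sigma>}. \<forall>j\<in>{..<num_types \<sigma>}.
      \<exists>l. walk \<sigma> i j l \<and> x < l \<and> l < x + \<epsilon>"
    by (intro eventually_ball_finite ballI) auto
  thus ?thesis by (rule eventually_mono) auto
qed

end


section \<open>Density of scales\<close>

lemma eps_dense_in_mono: "eps_dense_in \<epsilon> A I \<Longrightarrow> A \<subseteq> B \<Longrightarrow> eps_dense_in \<epsilon> B I"
  unfolding eps_dense_in_def by blast

lemma dense_in_if_eps_dense_in:
  assumes "\<And>\<epsilon>. \<epsilon> > 0 \<Longrightarrow> eps_dense_in \<epsilon> A I"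
  shows "dense_in A I"
  using assms unfolding dense_in_def eps_dense_in_def closure_approachable subset_iff
  by (metis dist_commute)

lemma abs_exp_diff_le_nonpos:
  fixes u v :: real
  assumes "u \<le> 0" "v \<le> 0"
  shows "\<bar>exp u - exp v\<bar> \<le> \<bar>u - v\<bar>"
proof -
  have *: "exp u - exp v \<le> u - v" if "v \<le> u" "u \<le> 0" for u v :: real
  proof -
    have "exp u - exp v = exp u * (1 - exp (v - u))" by (simp add: algebra_simps flip: exp_add)
    also have "\<dots> \<le> 1 * (1 - exp (v - u))" using that by (intro mult_right_mono) auto
    also have "\<dots> \<le> u - v" using exp_ge_add_one_self[of "v - u"] unfolding mult_1 by linarith
    finally show ?thesis .
  qed
  show ?thesis
  proof (cases "v \<le> u")
    case True
    hence "exp v \<le> exp u" by simp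
    thus ?thesis using *[of v u] True assms by simp
  next
    case False
    hence "exp u \<le> exp v" by simp
    thus ?thesis using *[of u v] False assms by simp
  qed
qed

context incommensurable_substitution
begin

text \<open>A tile of type \<open>j\<close> with legal scale \<open>\<alpha>\<close> is produced in the last step by substituting a tile of a
  type \<open>k\<close> for which the rule attains the smallest scale \<open>\<beta> = \<beta>\<^sub>j\<close>. This parent has scale \<open>\<alpha> / \<beta>\<close>, which
  exceeds 1 exactly because \<open>\<alpha> > \<beta>\<close>, so it is indeed substituted; the child is final as \<open>\<alpha> \<le> 1\<close>. A parent
  of almost this scale exists since the lengths of walks to \<open>k\<close> are eventually dense.\<close>

lemma generated_scales_eps_dense:
  assumes \<epsilon>: "\<epsilon> > 0"
  shows "\<forall>\<^sub>F t in at_top. \<forall>j<num_types \<sigma>. \<forall>i T. tile_of \<sigma> i (exp t) T \<longrightarrow>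
    eps_dense_in \<epsilon> (scales \<sigma> {S \<in> generated \<sigma> T. measure lebesgue S \<le> 1} j) {beta_min \<sigma> j<..1}"
proof -
  have "\<forall>\<^sub>F t in at_top. \<forall>i T. tile_of \<sigma> i (exp t) T \<longrightarrow>
    eps_dense_in \<epsilon> (scales \<sigma> {S \<in> generated \<sigma> T. measure lebesgue S \<le> 1} j) {beta_min \<sigma> j<..1}"
    if j: "j < num_types \<sigma>" for j
  proof -
    define \<beta> where "\<beta> = beta_min \<sigma> j"
    obtain k R where k: "k < num_types \<sigma>" "R \<in> rule \<sigma> (proto \<sigma> k)" "tile_of \<sigma> j \<beta> R"
      using beta_min_attained[OF j] unfolding \<beta>_def by blast
    have \<beta>: "0 < \<beta>" "\<beta> < 1" using k(3) rule_scale_less_1[OF k] by (auto simp: tile_of_def)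
    define L where "L = - ln \<beta>"
    have L: "0 < L" and \<beta>L: "\<beta> = exp (- L)" using \<beta> by (auto simp: L_def)
    define e where "e = min (\<epsilon> / 2) L"
    have e: "0 < e" "e < \<epsilon>" "e \<le> L" using \<epsilon> L by (auto simp: e_def)
    obtain X where X: "\<And>x i k. \<lbrakk>x \<ge> X; i < num_types \<sigma>; k < num_types \<sigma>\<rbrakk>
        \<Longrightarrow> \<exists>l. walk \<sigma> i k l \<and> x < l \<and> l < x + e"
      using walk_lengths_eventually_dense[OF e(1)] unfolding eventually_at_top_linorder by blast
    have "eps_dense_in \<epsilon> (scales \<sigma> {S \<in> generated \<sigma> T. measure lebesgue S \<le> 1} j) {\<beta><..1}"
      if t: "t \<ge> X + L + e" and T: "tile_of \<sigma> i (exp t) T" for t i T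
      unfolding eps_dense_in_def
    proof
      fix \<alpha> assume \<alpha>: "\<alpha> \<in> {\<beta><..1}"
      \<comment> \<open>The logarithmic scale of the ideal parent, which ranges over \<open>(0, L]\<close>.\<close>
      define y where "y = ln \<alpha> + L"
      have \<alpha>0: "0 < \<alpha>" using \<alpha> \<beta> by simp
      have "ln \<beta> < ln \<alpha>" "ln \<alpha> \<le> 0" using \<alpha> \<beta> \<alpha>0 by simp_all
      hence y: "0 < y" "y \<le> L" by (auto simp: y_def L_def)
      have \<alpha>y: "\<alpha> = exp (y - L)" using \<alpha>0 by (simp add: y_def)
      \<comment> \<open>A window of width \<open>e\<close> inside \<open>(0, L]\<close> and within \<open>e\<close> of \<open>y\<close>; it must not extend below 0,
      where the parent would not be substituted and the child's scale would not be legal.\<close>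
      define v where "v = max 0 (y - e)"
      have v: "0 \<le> v" "v + e \<le> L" "y - e \<le> v" "v < y" using y e by (auto simp: v_def)
      have i: "i < num_types \<sigma>" using T by (simp add: tile_of_def)
      obtain l where l: "walk \<sigma> i k l" "t - v - e < l" "l < t - v"
        using X[of "t - v - e" i k] i k(1) v t by auto
      define z where "z = t - l"
      have z: "v < z" "z < v + e" using l by (auto simp: z_def)
      have z0: "0 < z" "z \<le> L" "\<bar>y - z\<bar> < \<epsilon>" using z v e by auto
      have scale: "exp t * exp (- l) = exp z" by (simp add: z_def flip: exp_add)
      obtain U where U: "U \<in> generated \<sigma> T" "tile_of \<sigma> k (exp z) U"
        using walk_imp_generated[OF l(1) T] z0(1) unfolding scale by auto
      obtain S where S: "S \<in> subst_tile \<sigma> U" "tile_of \<sigma> j (exp z * \<beta>) S"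
        using subst_tileI[OF U(2) k(2,3)] by blast
      have "measure lebesgue U > 1" using measure_tile_of_gt_1[OF U(2)] z0 by simp
      hence gen: "S \<in> generated \<sigma> T" using U S by (blast intro: generated.step)
      define \<alpha>' where "\<alpha>' = exp (z - L)"
      have S\<alpha>: "tile_of \<sigma> j \<alpha>' S" using S(2) by (simp add: \<alpha>'_def \<beta>L flip: exp_add)
      have \<alpha>': "\<beta> < \<alpha>'" "\<alpha>' \<le> 1" using z0 by (auto simp: \<alpha>'_def \<beta>L)
      hence "measure lebesgue S \<le> 1" using measure_tile_of_gt_1[OF S\<alpha>] by simp
      hence "\<alpha>' \<in> scales \<sigma> {S \<in> generated \<sigma> T. measure lebesgue S \<le> 1} j \<inter> {\<beta><..1}"
        using gen S\<alpha> \<alpha>' unfolding scales_def by auto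
      moreover have "dist \<alpha> \<alpha>' < \<epsilon>"
        using abs_exp_diff_le_nonpos[of "y - L" "z - L"] y z0 by (simp add: \<alpha>y \<alpha>'_def dist_real_def)
      ultimately show "\<exists>a\<in>scales \<sigma> {S \<in> generated \<sigma> T. measure lebesgue S \<le> 1} j \<inter> {\<beta><..1}.
          dist \<alpha> a < \<epsilon>" by blast
    qed
    thus ?thesis unfolding eventually_at_top_linorder \<beta>_def by blast
  qed
  hence "\<forall>\<^sub>F t in at_top. \<forall>j\<in>{..<num_types \<sigma>}. \<forall>i T. tile_of \<sigma> i (exp t) T \<longrightarrow>
    eps_dense_in \<epsilon> (scales \<sigma> {S \<in> generated \<sigma> T. measure lebesgue S \<le> 1} j) {beta_min \<sigma> j<..1}"
    by (intro eventually_ball_finite ballI) auto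
  thus ?thesis by (rule eventually_mono) auto
qed

text \<open>The patch on \<open>e\<^bsup>ks\<^esup> T\<close> contains all final tiles generated from \<open>e\<^bsup>ks\<^esup> T\<close>. A common
  lower bound \<open>c\<close> for the scales in \<open>S\<close> gives \<open>e\<^bsup>ks\<^esup> T\<close> at least the scale \<open>e\<^bsup>ks\<^esup> c\<close>, which makes \<open>K\<close>
  independent of \<open>T\<close>.\<close>

lemma fixed_tiling_eps_dense:
  assumes S: "S \<in> tiling_space \<sigma>" and s: "s > 0" "flow \<sigma> s S = S" and \<epsilon>: "\<epsilon> > 0"
  shows "\<exists>K::nat. \<forall>k\<ge>K. flow \<sigma> (real k * s) S = S \<and>
    (\<forall>T\<in>S. \<forall>j < num_types \<sigma>. eps_dense_in \<epsilon>
      (scales \<sigma> (patch_on (flow \<sigma> (real k * s) S) (copy 0 (exp (real k * s)) T)) j)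
      {beta_min \<sigma> j<..1})"
proof -
  obtain c where c: "0 < c" "\<And>T j \<alpha>. \<lbrakk>T \<in> S; tile_of \<sigma> j \<alpha> T\<rbrakk> \<Longrightarrow> c \<le> \<alpha>"
    using tiling_space_scales_lower_bound S by metis
  obtain X where X: "\<And>t i j T. \<lbrakk>t \<ge> X; j < num_types \<sigma>; tile_of \<sigma> i (exp t) T\<rbrakk> \<Longrightarrow>
    eps_dense_in \<epsilon> (scales \<sigma> {S \<in> generated \<sigma> T. measure lebesgue S \<le> 1} j) {beta_min \<sigma> j<..1}"
    using generated_scales_eps_dense[OF \<epsilon>] unfolding eventually_at_top_linorder by blast
  have legal: "\<exists>j \<alpha>. \<alpha> \<le> 1 \<and> tile_of \<sigma> j \<alpha> T" if "T \<in> S" for T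
    using S that unfolding tiling_space_def by blast
  have "measure lebesgue T \<le> 1" if "T \<in> S" for T
    using legal[OF that] measure_tile_of_gt_1 by (metis linorder_not_less)
  hence fixed: "flow \<sigma> (real k * s) S = S" for k
    using flow_fixed_multiples s by (metis less_imp_le)
  obtain K :: nat where K: "X - ln c < K * s" using reals_Archimedean3[OF s(1)] by blast
  have "eps_dense_in \<epsilon> (scales \<sigma> (patch_on S (copy 0 (exp (real k * s)) T)) j) {beta_min \<sigma> j<..1}"
    if k: "k \<ge> K" and T: "T \<in> S" and j: "j < num_types \<sigma>" for k T j
  proof -
    let ?T = "copy 0 (exp (real k * s)) T"
    obtain i \<alpha> where i: "tile_of \<sigma> i \<alpha> T" using legal[OF T] by blast
    have \<alpha>: "0 < \<alpha>" "c \<le> \<alpha>" using i c(2)[OF T i] by (auto simp: tile_of_def)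
    have "tile_of \<sigma> i (exp (real k * s + ln \<alpha>)) ?T"
      using tile_of_copy[OF i, of "exp (real k * s)" 0] \<alpha>(1) by (simp add: exp_add)
    moreover have "real k * s + ln \<alpha> \<ge> X"
    proof -
      have "real K * s \<le> real k * s" using k s(1) by simp
      moreover have "ln c \<le> ln \<alpha>" using \<alpha> c(1) by simp
      ultimately show ?thesis using K by linarith
    qed
    ultimately have "eps_dense_in \<epsilon> (scales \<sigma> {S \<in> generated \<sigma> ?T. measure lebesgue S \<le> 1} j)
        {beta_min \<sigma> j<..1}"
      using X j by blast
    moreover have "{U \<in> generated \<sigma> ?T. measure lebesgue U \<le> 1} \<subseteq> patch_on S ?T"
    proof
      fix U assume U: "U \<in> {U \<in> generated \<sigma> ?T. measure lebesgue U \<le> 1}"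
      hence "U \<in> flow \<sigma> (real k * s) S" using T by (auto simp: flow_def)
      thus "U \<in> patch_on S ?T" using U generated_subset fixed by (auto simp: patch_on_def)
    qed
    hence "scales \<sigma> {U \<in> generated \<sigma> ?T. measure lebesgue U \<le> 1} j \<subseteq> scales \<sigma> (patch_on S ?T) j"
      unfolding scales_def by blast
    ultimately show ?thesis by (rule eps_dense_in_mono)
  qed
  thus ?thesis unfolding fixed by blast
qed

text \<open>The patches that exhaust a stationary tiling are patches \<open>F\<^sub>t(T\<^sub>i)\<close> with \<open>t\<close> arbitrarily large, so
  for every \<open>\<epsilon>\<close> one of them already has \<open>\<epsilon>\<close>-dense scales.\<close>

lemma stationary_tiling_dense:
  assumes S: "stationary_tiling \<sigma> S" and j: "j < num_types \<sigma>"
  shows "dense_in (scales \<sigma> S j) {beta_min \<sigma> j<..1}"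
proof (rule dense_in_if_eps_dense_in)
  fix \<epsilon> :: real assume \<epsilon>: "\<epsilon> > 0"
  obtain X where X: "\<And>t i T. \<lbrakk>t \<ge> X; tile_of \<sigma> i (exp t) T\<rbrakk> \<Longrightarrow>
    eps_dense_in \<epsilon> (scales \<sigma> {S \<in> generated \<sigma> T. measure lebesgue S \<le> 1} j) {beta_min \<sigma> j<..1}"
    using generated_scales_eps_dense[OF \<epsilon>] j unfolding eventually_at_top_linorder by blast
  obtain i s a x where i: "i < num_types \<sigma>" and s: "s > 0"
    and S_eq: "S = (\<Union>k::nat. flow \<sigma> (a + real k * s) {copy x 1 (proto \<sigma> i)})"
    using S unfolding stationary_tiling_def Let_def by blast
  obtain k :: nat where k: "X - a < k * s" using reals_Archimedean3[OF s] by blast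
  define t where "t = a + real k * s"
  let ?T = "copy 0 (exp t) (copy x 1 (proto \<sigma> i))"
  have "tile_of \<sigma> i (exp t) ?T" using i unfolding tile_of_def copy_copy by auto
  moreover have "t \<ge> X" using k by (simp add: t_def)
  ultimately have "eps_dense_in \<epsilon> (scales \<sigma> {S \<in> generated \<sigma> ?T. measure lebesgue S \<le> 1} j)
      {beta_min \<sigma> j<..1}"
    using X by blast
  moreover have "{U \<in> generated \<sigma> ?T. measure lebesgue U \<le> 1} \<subseteq> S"
    unfolding S_eq t_def flow_def by blast
  hence "scales \<sigma> {U \<in> generated \<sigma> ?T. measure lebesgue U \<le> 1} j \<subseteq> scales \<sigma> S j"
    unfolding scales_def by blast
  ultimately show "eps_dense_in \<epsilon> (scales \<sigma> S j) {beta_min \<sigma> j<..1}" by (rule eps_dense_in_mono)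
qed

end

theorem theorem5p2:
  fixes \<sigma> :: "'a::euclidean_space scheme"
  assumes "substitution_scheme \<sigma>" and "normalized \<sigma>" and "geometrically_different \<sigma>"
    and "irreducible_scheme \<sigma>" and "incommensurable \<sigma>"
  shows "(\<forall>S s \<epsilon>. S \<in> tiling_space \<sigma> \<and> s > 0 \<and> flow \<sigma> s S = S \<and> \<epsilon> > 0 \<longrightarrow>
            (\<exists>K::nat. \<forall>k\<ge>K.
               flow \<sigma> (real k * s) S = S \<and>
               (\<forall>T\<in>S. \<forall>j < num_types \<sigma>.
                  eps_dense_in \<epsilon>
                    (scales \<sigma> (patch_on (flow \<sigma> (real k * s) S) (copy 0 (exp (real k * s)) T)) j)
                    {beta_min \<sigma> j<..1})))
       \<and> (\<forall>S. stationary_tiling \<sigma> S \<longrightarrow>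
            (\<forall>j < num_types \<sigma>. dense_in (scales \<sigma> S j) {beta_min \<sigma> j<..1}))"
proof -
  interpret incommensurable_substitution \<sigma> by unfold_locales (fact assms)+
  show ?thesis
  proof (intro conjI allI impI; (elim conjE)?)
    fix S s and \<epsilon> :: real
    assume "S \<in> tiling_space \<sigma>" "s > 0" "flow \<sigma> s S = S" "\<epsilon> > 0"
    thus "\<exists>K::nat. \<forall>k\<ge>K. flow \<sigma> (real k * s) S = S \<and>
        (\<forall>T\<in>S. \<forall>j < num_types \<sigma>. eps_dense_in \<epsilon>
          (scales \<sigma> (patch_on (flow \<sigma> (real k * s) S) (copy 0 (exp (real k * s)) T)) j)
          {beta_min \<sigma> j<..1})"
      by (rule fixed_tiling_eps_dense)
  qed (rule stationary_tiling_dense)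
qed

end
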